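(* The following horofunctions of the lamplighter group $L_2$ (with the word metric for $\{t,at\}$) are all pairwise distinct functions on $L_2$: $\mathfrak s^l$ for $l\in\mathbb Z$; $H$ and $-H$; $\mathfrak r^{+,f}$ for $f\in L_2$ with $M(f)<H(f)$; $\mathfrak r^{-,f}$ for $f\in L_2$ with $m(f)\ge H(f)$; $\mathfrak b^{+,\gamma}$ for $[\gamma]\in\partial_\infty L_2^+$; and $\mathfrak b^{-,\gamma}$ for $[\gamma]\in\partial_\infty L_2^-$.
   Context: Lamplighter group: $L_2=\langle a,t\mid a^2,\ [a^{t^i},a^{t^j}]\ \forall i,j\in\mathbb Z\rangle\cong(\bigoplus_{\mathbb Z}\mathbb Z/2)\rtimes\mathbb Z$. Each element is identified with a lamp stand: a finite set of lit lamps (positions in $\mathbb Z$) together with an integer position of the lamplighter. The identity $id$ has no lit lamps and lamplighter at $0$; right multiplication by $a$ toggles the lamp at the lamplighter's position; right multiplication by $t$ moves the lamplighter by $+1$. $d$ is the word metric on $L_2$ with respect to $S=\{t,at\}$, i.e. $d(g,h)$ is the length of $g^{-1}h$ in $S\cup S^{-1}$. $H(g)$ is the lamplighter's position in $g$; $m(g)$ (resp. $M(g)$) is the minimum (resp. maximum) position of a lit lamp of $g$, with $m(g)=+\infty$, $M(g)=-\infty$ if no lamp is lit. $m(g_1,g_2)$ (resp. $M(g_1,g_2)$) is the minimum (resp. maximum) position of a lamp whose status differs in $g_1$ and $g_2$, with value $+\infty$ (resp. $-\infty$) if there is none. A geodesic ray is an isometric embedding $\gamma:\mathbb N\to L_2$;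 two rays are asymptotic if $\sup_n d(\gamma(n),\gamma'(n))<\infty$; $\partial_\infty L_2^{\pm}$ is the set of asymptotic classes $[\gamma]$ of geodesic rays with $\gamma(0)=id$ and $H(\gamma(n))\to\pm\infty$. For such a ray each lamp's status in $\gamma(n)$ is eventually constant; the resulting (possibly infinite) configuration is the infinite lamp stand of $\gamma$, which depends only on $[\gamma]$; $m(\gamma),m(\gamma,g)$ (for $\partial_\infty L_2^+$) and $M(\gamma),M(\gamma,g)$ (for $\partial_\infty L_2^-$) are defined from it as for group elements. Formulas, for $g\in L_2$: $\mathfrak b^{+,\gamma}(g)=2(\min\{m(\gamma),0\}-\min\{m(\gamma,g),H(g)\})+H(g)$ for $[\gamma]\in\partial_\infty L_2^+$; $\mathfrak b^{-,\gamma}(g)=2(\max\{M(\gamma,g)+1,H(g)\}-\max\{M(\gamma)+1,0\})-H(g)$ for $[\gamma]\in\partial_\infty L_2^-$; $\mathfrak s^l(g)=|l|-|l-H(g)|$; $\mathfrak r^{+,f}(g)=2(\min\{m(f),l,0\}-\min\{m(f,g),H(g),l\})+\mathfrak s^l(g)$ where $l=H(f)$ and $M(f)<l$; $\mathfrak r^{-,f}(g)=2(\max\{M(f,g)+1,H(g),l\}-\max\{M(f)+1,l,0\})+\mathfrak s^l(g)$ where $l=H(f)$ and $m(f)\ge l$. The functions are indexed by distinct parameters: distinct integers $l$, distinct elements $f$, distinct asymptotic classes $[\gamma]$. *)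

theory Defs
  imports "HOL-Algebra.Algebra" "HOL-Library.FSet" "HOL-Library.Extended_Real"
begin

section \<open>The lamplighter group\<close>

datatype lampstand = Lampstand (lamps: "int fset") (pos: int)

text \<open>\<open>lit g\<close> is the set of lit lamps of \<open>g\<close>; \<open>pos g\<close> is the position of the lamplighter, written
  $H(g)$ in the literature.\<close>

abbreviation lit :: "lampstand \<Rightarrow> int set" where
  "lit g \<equiv> fset (lamps g)"

text \<open>The wreath product multiplication: the configuration of the second factor is shifted to the
  position of the first lamplighter and added modulo 2.\<close>

definition lamp_mult :: "lampstand \<Rightarrow> lampstand \<Rightarrow> lampstand" where
  "lamp_mult g h =
     (let B = (\<lambda>i. i + pos g) |`| lamps h
      in Lampstand ((lamps g |-| B) |\<union>| (B |-| lamps g)) (pos g + pos h))"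

definition L2 :: "lampstand monoid" where
  "L2 = \<lparr>carrier = UNIV, monoid.mult = lamp_mult, one = Lampstand {||} 0\<rparr>"

definition gen_a :: lampstand where "gen_a = Lampstand {|0|} 0"

definition gen_t :: lampstand where "gen_t = Lampstand {||} 1"

definition word_length :: "('a, 'b) monoid_scheme \<Rightarrow> 'a set \<Rightarrow> 'a \<Rightarrow> nat" where
  "word_length G S g =
     (LEAST n. \<exists>ws. set ws \<subseteq> S \<union> m_inv G ` S \<and> length ws = n \<and> foldr (monoid.mult G) ws \<one>\<^bsub>G\<^esub> = g)"

definition L2_dist :: "lampstand \<Rightarrow> lampstand \<Rightarrow> nat" where
  "L2_dist g h = word_length L2 {gen_t, gen_a \<otimes>\<^bsub>L2\<^esub> gen_t} (inv\<^bsub>L2\<^esub> g \<otimes>\<^bsub>L2\<^esub> h)"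

lemma lit_mult: "lit (g \<otimes>\<^bsub>L2\<^esub> h) = sym_diff (lit g) ((\<lambda>i. i + pos g) ` lit h)"
  and pos_mult: "pos (g \<otimes>\<^bsub>L2\<^esub> h) = pos g + pos h"
  and lit_one: "lit \<one>\<^bsub>L2\<^esub> = {}"
  and pos_one: "pos \<one>\<^bsub>L2\<^esub> = 0"
  by (simp_all add: L2_def lamp_mult_def Let_def)

lemma lit_mult_iff: "i \<in> lit (g \<otimes>\<^bsub>L2\<^esub> h) \<longleftrightarrow> (i \<in> lit g) \<noteq> (i - pos g \<in> lit h)"
proof -
  have "i \<in> (\<lambda>i. i + pos g) ` lit h \<longleftrightarrow> i - pos g \<in> lit h"
    by (auto simp: image_iff intro: bexI[of _ "i - pos g"])
  then show ?thesis by (auto simp: lit_mult)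
qed

lemma lampstand_eqI: "lit g = lit h \<Longrightarrow> pos g = pos h \<Longrightarrow> g = h"
  by (simp add: lampstand.expand fset_inject)

lemma carrier_L2 [simp]: "carrier L2 = UNIV"
  by (simp add: L2_def)

lemma group_L2: "group L2"
proof (rule groupI)
  fix x y z
  show "x \<otimes>\<^bsub>L2\<^esub> y \<otimes>\<^bsub>L2\<^esub> z = x \<otimes>\<^bsub>L2\<^esub> (y \<otimes>\<^bsub>L2\<^esub> z)"
    by (rule lampstand_eqI) (auto simp del: fset_simps simp: set_eq_iff lit_mult_iff pos_mult algebra_simps)
next
  fix x
  show "\<one>\<^bsub>L2\<^esub> \<otimes>\<^bsub>L2\<^esub> x = x"
    by (rule lampstand_eqI) (auto simp: set_eq_iff lit_mult_iff pos_mult lit_one pos_one)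
  let ?y = "Lampstand ((\<lambda>i. i - pos x) |`| lamps x) (- pos x)"
  have "i + pos x \<in> lit x" if "i \<in> lit ?y" for i using that by auto
  moreover have "i \<in> lit ?y" if "i + pos x \<in> lit x" for i
    using that by (auto simp: image_iff intro!: bexI[of _ "i + pos x"])
  ultimately have "?y \<otimes>\<^bsub>L2\<^esub> x = \<one>\<^bsub>L2\<^esub>"
    by (intro lampstand_eqI) (auto simp del: fset_simps simp: set_eq_iff lit_mult_iff pos_mult lit_one pos_one)
  then show "\<exists>y\<in>carrier L2. y \<otimes>\<^bsub>L2\<^esub> x = \<one>\<^bsub>L2\<^esub>" by auto
qed simp_all

interpretation L2: group L2 by (rule group_L2)

lemma mult_gen_a: "lit (g \<otimes>\<^bsub>L2\<^esub> gen_a) = sym_diff (lit g) {pos g}" "pos (g \<otimes>\<^bsub>L2\<^esub> gen_a) = pos g"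
  by (simp_all add: lit_mult pos_mult gen_a_def)

lemma mult_gen_t: "lit (g \<otimes>\<^bsub>L2\<^esub> gen_t) = lit g" "pos (g \<otimes>\<^bsub>L2\<^esub> gen_t) = pos g + 1"
  by (simp_all add: lit_mult pos_mult gen_t_def)

section \<open>Extremal lamps\<close>

text \<open>In \<^typ>\<open>ereal\<close> the infimum of the empty set is \<open>\<infinity>\<close> and its supremum is \<open>-\<infinity>\<close>.\<close>

definition min_lamp :: "int set \<Rightarrow> ereal" where
  "min_lamp A = (INF i\<in>A. ereal (of_int i))"

definition max_lamp :: "int set \<Rightarrow> ereal" where
  "max_lamp A = (SUP i\<in>A. ereal (of_int i))"

definition min_diff :: "int set \<Rightarrow> int set \<Rightarrow> ereal" where
  "min_diff A B = min_lamp (sym_diff A B)"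

definition max_diff :: "int set \<Rightarrow> int set \<Rightarrow> ereal" where
  "max_diff A B = max_lamp (sym_diff A B)"

section \<open>Geodesic rays and the boundary\<close>

definition geodesic_ray :: "(nat \<Rightarrow> lampstand) \<Rightarrow> bool" where
  "geodesic_ray \<gamma> \<longleftrightarrow> (\<forall>m n. int (L2_dist (\<gamma> m) (\<gamma> n)) = \<bar>int m - int n\<bar>)"

definition asymptotic :: "(nat \<Rightarrow> lampstand) \<Rightarrow> (nat \<Rightarrow> lampstand) \<Rightarrow> bool" where
  "asymptotic \<gamma> \<gamma>' \<longleftrightarrow> bdd_above (range (\<lambda>n. L2_dist (\<gamma> n) (\<gamma>' n)))"

text \<open>The filter \<open>F\<close> is \<^const>\<open>at_top\<close> or \<^const>\<open>at_bot\<close>, for rays with $H \to +\infty$ or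
  $H \to -\infty$.\<close>

definition rays :: "int filter \<Rightarrow> (nat \<Rightarrow> lampstand) set" where
  "rays F = {\<gamma>. geodesic_ray \<gamma> \<and> \<gamma> 0 = \<one>\<^bsub>L2\<^esub> \<and> filterlim (\<lambda>n. pos (\<gamma> n)) F sequentially}"

definition asymptotic_rel :: "int filter \<Rightarrow> ((nat \<Rightarrow> lampstand) \<times> (nat \<Rightarrow> lampstand)) set" where
  "asymptotic_rel F = {(\<gamma>, \<gamma>'). \<gamma> \<in> rays F \<and> \<gamma>' \<in> rays F \<and> asymptotic \<gamma> \<gamma>'}"

definition boundary :: "int filter \<Rightarrow> (nat \<Rightarrow> lampstand) set set" where
  "boundary F = rays F // asymptotic_rel F"

definition limit_lamps :: "(nat \<Rightarrow> lampstand) \<Rightarrow> int set" where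
  "limit_lamps \<gamma> = {i. \<forall>\<^sub>F n in sequentially. i \<in> lit (\<gamma> n)}"

text \<open>All members of a boundary class have the same limit configuration
  (\<open>class_lamps_eq\<close> below), so \<^const>\<open>the_elem\<close> is applied to a singleton.\<close>

definition class_lamps :: "(nat \<Rightarrow> lampstand) set \<Rightarrow> int set" where
  "class_lamps c = the_elem (limit_lamps ` c)"

subsection \<open>Well-definedness of the limit configuration\<close>

abbreviation L2_letters :: "lampstand set" where
  "L2_letters \<equiv> {gen_t, gen_a \<otimes>\<^bsub>L2\<^esub> gen_t} \<union> m_inv L2 ` {gen_t, gen_a \<otimes>\<^bsub>L2\<^esub> gen_t}"

abbreviation L2_word :: "lampstand list \<Rightarrow> lampstand" where
  "L2_word ws \<equiv> foldr (monoid.mult L2) ws \<one>\<^bsub>L2\<^esub>"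

lemma inv_t: "inv\<^bsub>L2\<^esub> gen_t = Lampstand {||} (-1)"
  by (rule L2.inv_equality) (auto intro!: lampstand_eqI simp: lit_mult pos_mult lit_one pos_one gen_t_def)

lemma at_eq: "gen_a \<otimes>\<^bsub>L2\<^esub> gen_t = Lampstand {|0|} 1"
  by (rule lampstand_eqI) (auto simp: lit_mult pos_mult gen_t_def gen_a_def)

lemma inv_at: "inv\<^bsub>L2\<^esub> (gen_a \<otimes>\<^bsub>L2\<^esub> gen_t) = Lampstand {|-1|} (-1)"
  unfolding at_eq
  by (rule L2.inv_equality) (auto intro!: lampstand_eqI simp: lit_mult pos_mult lit_one pos_one)

lemma letters_eq:
  "L2_letters = {Lampstand {||} 1, Lampstand {|0|} 1, Lampstand {||} (-1), Lampstand {|-1|} (-1)}"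
  unfolding image_insert image_empty inv_t inv_at
  unfolding at_eq unfolding gen_t_def by blast

lemma L2_word_append: "L2_word (us @ vs) = L2_word us \<otimes>\<^bsub>L2\<^esub> L2_word vs"
  by (induction us) (simp_all add: L2.m_assoc)

lemma L2_generated: "\<exists>ws. set ws \<subseteq> L2_letters \<and> L2_word ws = g"
proof -
  define P where "P g \<longleftrightarrow> (\<exists>ws. set ws \<subseteq> L2_letters \<and> L2_word ws = g)" for g
  have mult: "P (g \<otimes>\<^bsub>L2\<^esub> h)" if gh: "P g" "P h" for g h
  proof -
    obtain us vs where "set us \<subseteq> L2_letters" "L2_word us = g" "set vs \<subseteq> L2_letters" "L2_word vs = h"
      using gh unfolding P_def by blast
    then show ?thesis
      unfolding P_def by (intro exI[of _ "us @ vs"]) (simp only: set_append Un_least L2_word_append simp_thms)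
  qed
  have letter: "P x"
    if "x \<in> {Lampstand {||} 1, Lampstand {|0|} 1, Lampstand {||} (-1), Lampstand {|-1|} (-1)}" for x
  proof -
    have "set [x] \<subseteq> L2_letters"
      using that unfolding letters_eq by simp
    moreover have "L2_word [x] = x" by simp
    ultimately show ?thesis unfolding P_def by blast
  qed
  have one: "P \<one>\<^bsub>L2\<^esub>" unfolding P_def by (intro exI[of _ "[]"]) simp
  have right: "P (Lampstand {||} (int n))" for n
  proof (induction n)
    case 0 then show ?case using one by (simp add: L2_def)
  next
    case (Suc n)
    have "Lampstand {||} (int (Suc n)) = Lampstand {||} (int n) \<otimes>\<^bsub>L2\<^esub> Lampstand {||} 1"
      by (rule lampstand_eqI) (auto simp: lit_mult pos_mult)
    then show ?case using mult[OF Suc letter] by simp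
  qed
  have left: "P (Lampstand {||} (- int n))" for n
  proof (induction n)
    case 0 then show ?case using one by (simp add: L2_def)
  next
    case (Suc n)
    have "Lampstand {||} (- int (Suc n)) = Lampstand {||} (- int n) \<otimes>\<^bsub>L2\<^esub> Lampstand {||} (-1)"
      by (rule lampstand_eqI) (auto simp: lit_mult pos_mult)
    then show ?case using mult[OF Suc letter] by simp
  qed
  have shift: "P (Lampstand {||} k)" for k
    using right left by (cases k rule: int_cases2) auto
  have a: "P (Lampstand {|0|} 0)"
  proof -
    have "Lampstand {|0|} 0 = Lampstand {|0|} 1 \<otimes>\<^bsub>L2\<^esub> Lampstand {||} (-1)"
      by (rule lampstand_eqI) (auto simp: lit_mult pos_mult)
    then show ?thesis using mult[OF letter letter] by simp
  qed
  have "P (Lampstand A k)" for A k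
  proof (induction A arbitrary: k)
    case empty show ?case by (rule shift)
  next
    case (insert i A)
    have "Lampstand (finsert i A) k =
        (Lampstand {||} i \<otimes>\<^bsub>L2\<^esub> Lampstand {|0|} 0) \<otimes>\<^bsub>L2\<^esub> (Lampstand {||} (- i) \<otimes>\<^bsub>L2\<^esub> Lampstand A k)"
      using insert.hyps by (intro lampstand_eqI) (auto simp: lit_mult pos_mult image_image)
    then show ?case using mult[OF mult[OF shift a] mult[OF shift insert.IH]] by simp
  qed
  then show ?thesis unfolding P_def by (metis lampstand.exhaust)
qed

lemma L2_word_bounds:
  "set ws \<subseteq> L2_letters \<Longrightarrow>
    \<bar>pos (L2_word ws)\<bar> \<le> int (length ws) \<and> (\<forall>i\<in>lit (L2_word ws). \<bar>i\<bar> \<le> int (length ws))"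
proof (induction ws)
  case Nil then show ?case by (simp add: lit_one pos_one)
next
  case (Cons x ws)
  have IH: "\<bar>pos (L2_word ws)\<bar> \<le> int (length ws)"
    "\<And>i. i \<in> lit (L2_word ws) \<Longrightarrow> \<bar>i\<bar> \<le> int (length ws)"
    using Cons by auto
  have x: "\<bar>pos x\<bar> = 1 \<and> (\<forall>i\<in>lit x. \<bar>i\<bar> \<le> 1)"
    using Cons.prems unfolding letters_eq by auto
  show ?case
  proof (intro conjI ballI)
    show "\<bar>pos (L2_word (x # ws))\<bar> \<le> int (length (x # ws))"
      using IH(1) x unfolding foldr.simps o_apply pos_mult length_Cons by linarith
    fix i assume "i \<in> lit (L2_word (x # ws))"
    then have "i \<in> lit x \<or> i - pos x \<in> lit (L2_word ws)" by (auto simp: lit_mult_iff)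
    then show "\<bar>i\<bar> \<le> int (length (x # ws))" using x IH(2)[of "i - pos x"] by fastforce
  qed
qed

lemma L2_dist_lit:
  assumes "int (L2_dist g h) < \<bar>i - pos g\<bar>"
  shows "i \<in> lit g \<longleftrightarrow> i \<in> lit h"
proof -
  let ?k = "inv\<^bsub>L2\<^esub> g \<otimes>\<^bsub>L2\<^esub> h"
  have "\<exists>n ws. set ws \<subseteq> L2_letters \<and> length ws = n \<and> L2_word ws = ?k"
    using L2_generated by blast
  from LeastI_ex[OF this] obtain ws
    where ws: "set ws \<subseteq> L2_letters" "length ws = L2_dist g h" "L2_word ws = ?k"
    unfolding L2_dist_def word_length_def by blast
  have "i - pos g \<notin> lit ?k"
    using L2_word_bounds[OF ws(1)] assms ws(2,3) by fastforce
  moreover have "g \<otimes>\<^bsub>L2\<^esub> ?k = h" by (simp add: L2.m_assoc[symmetric])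
  ultimately show ?thesis by (metis lit_mult_iff)
qed

lemma ray_leaves:
  assumes "F = at_top \<or> F = at_bot" "\<gamma> \<in> rays F"
  shows "\<forall>\<^sub>F n in sequentially. C < \<bar>i - pos (\<gamma> n)\<bar>"
  using assms(1)
proof
  assume "F = at_top"
  then have "\<forall>\<^sub>F n in sequentially. i + \<bar>C\<bar> + 1 \<le> pos (\<gamma> n)"
    using assms(2) unfolding rays_def \<open>F = at_top\<close> mem_Collect_eq filterlim_at_top by blast
  then show ?thesis by eventually_elim linarith
next
  assume "F = at_bot"
  then have "\<forall>\<^sub>F n in sequentially. pos (\<gamma> n) \<le> i - \<bar>C\<bar> - 1"
    using assms(2) unfolding rays_def \<open>F = at_bot\<close> mem_Collect_eq filterlim_at_bot by blast
  then show ?thesis by eventually_elim linarith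
qed

lemma eventually_limit_lamps:
  assumes "F = at_top \<or> F = at_bot" "\<gamma> \<in> rays F"
  shows "\<forall>\<^sub>F n in sequentially. i \<in> lit (\<gamma> n) \<longleftrightarrow> i \<in> limit_lamps \<gamma>"
proof -
  have d: "int (L2_dist (\<gamma> n) (\<gamma> (Suc n))) = 1" for n
    using assms(2) by (simp add: rays_def geodesic_ray_def)
  obtain N where N: "\<And>n. n \<ge> N \<Longrightarrow> 1 < \<bar>i - pos (\<gamma> n)\<bar>"
    using ray_leaves[OF assms, of 1 i] unfolding eventually_sequentially by blast
  have const: "i \<in> lit (\<gamma> n) \<longleftrightarrow> i \<in> lit (\<gamma> N)" if "n \<ge> N" for n
    using that
  proof (induction rule: dec_induct)
    case (step n)
    then show ?case using L2_dist_lit[of "\<gamma> n" "\<gamma> (Suc n)" i] d[of n] N[of n] by auto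
  qed simp
  then have ev: "\<forall>\<^sub>F n in sequentially. i \<in> lit (\<gamma> n) \<longleftrightarrow> i \<in> lit (\<gamma> N)"
    unfolding eventually_sequentially by blast
  have "i \<in> limit_lamps \<gamma> \<longleftrightarrow> i \<in> lit (\<gamma> N)"
    unfolding limit_lamps_def mem_Collect_eq
    by (subst eventually_cong[OF ev, of "\<lambda>n. i \<in> lit (\<gamma> n)" "\<lambda>n. i \<in> lit (\<gamma> N)"]) auto
  with ev show ?thesis by simp
qed

lemma asymptotic_limit_lamps:
  assumes "F = at_top \<or> F = at_bot" "(\<gamma>, \<gamma>') \<in> asymptotic_rel F"
  shows "limit_lamps \<gamma> = limit_lamps \<gamma>'"
proof -
  from assms(2) have ray: "\<gamma> \<in> rays F" "asymptotic \<gamma> \<gamma>'" by (auto simp: asymptotic_rel_def)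
  then obtain C where C: "\<And>n. L2_dist (\<gamma> n) (\<gamma>' n) \<le> C"
    unfolding asymptotic_def bdd_above_def by blast
  have "i \<in> limit_lamps \<gamma> \<longleftrightarrow> i \<in> limit_lamps \<gamma>'" for i
    unfolding limit_lamps_def mem_Collect_eq
  proof (rule eventually_cong[OF ray_leaves[OF assms(1) ray(1), of "int C" i]])
    fix n assume "int C < \<bar>i - pos (\<gamma> n)\<bar>"
    then show "i \<in> lit (\<gamma> n) \<longleftrightarrow> i \<in> lit (\<gamma>' n)"
      using C[of n] by (intro L2_dist_lit) linarith
  qed
  then show ?thesis by blast
qed

lemma class_lamps_eq:
  assumes "F = at_top \<or> F = at_bot" "\<gamma> \<in> rays F"
  shows "class_lamps (asymptotic_rel F `` {\<gamma>}) = limit_lamps \<gamma>"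
proof -
  have "L2_dist g g = 0" for g
    unfolding L2_dist_def word_length_def by (rule Least_eq_0) simp
  then have "(\<gamma>, \<gamma>) \<in> asymptotic_rel F"
    using assms(2) by (simp add: asymptotic_rel_def asymptotic_def)
  then have mem: "\<gamma> \<in> asymptotic_rel F `` {\<gamma>}" by blast
  have "limit_lamps \<gamma>' = limit_lamps \<gamma>" if "\<gamma>' \<in> asymptotic_rel F `` {\<gamma>}" for \<gamma>'
    using asymptotic_limit_lamps[OF assms(1)] that by (metis Image_singleton_iff)
  then have "limit_lamps ` (asymptotic_rel F `` {\<gamma>}) = {limit_lamps \<gamma>}"
    using mem by blast
  then show ?thesis by (simp add: class_lamps_def)
qed

section \<open>The horofunctions\<close>

text \<open>For the parameters admitted in the theorem every extremum below is finite, so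
  \<^const>\<open>real_of_ereal\<close> loses nothing.\<close>

definition b_plus :: "(nat \<Rightarrow> lampstand) set \<Rightarrow> lampstand \<Rightarrow> real" where
  "b_plus c g =
     2 * (real_of_ereal (min (min_lamp (class_lamps c)) 0)
          - real_of_ereal (min (min_diff (class_lamps c) (lit g)) (ereal (pos g))))
     + of_int (pos g)"

definition b_minus :: "(nat \<Rightarrow> lampstand) set \<Rightarrow> lampstand \<Rightarrow> real" where
  "b_minus c g =
     2 * (real_of_ereal (max (max_diff (class_lamps c) (lit g) + 1) (ereal (pos g)))
          - real_of_ereal (max (max_lamp (class_lamps c) + 1) 0))
     - of_int (pos g)"

definition s_fun :: "int \<Rightarrow> lampstand \<Rightarrow> real" where
  "s_fun l g = of_int (\<bar>l\<bar> - \<bar>l - pos g\<bar>)"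

definition r_plus :: "lampstand \<Rightarrow> lampstand \<Rightarrow> real" where
  "r_plus f g =
     (let l = pos f in
      2 * (real_of_ereal (min (min_lamp (lit f)) (min (ereal l) 0))
           - real_of_ereal (min (min_diff (lit f) (lit g)) (min (ereal (pos g)) (ereal l))))
      + s_fun l g)"

definition r_minus :: "lampstand \<Rightarrow> lampstand \<Rightarrow> real" where
  "r_minus f g =
     (let l = pos f in
      2 * (real_of_ereal (max (max_diff (lit f) (lit g) + 1) (max (ereal (pos g)) (ereal l)))
           - real_of_ereal (max (max_lamp (lit f) + 1) (max (ereal l) 0)))
      + s_fun l g)"

datatype horo_index =
    S_index int
  | H_index
  | Neg_H_index
  | R_plus_index lampstand
  | R_minus_index lampstand
  | B_plus_index "(nat \<Rightarrow> lampstand) set"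
  | B_minus_index "(nat \<Rightarrow> lampstand) set"

primrec horofunction :: "horo_index \<Rightarrow> lampstand \<Rightarrow> real" where
  "horofunction (S_index l) = s_fun l"
| "horofunction H_index = (\<lambda>g. of_int (pos g))"
| "horofunction Neg_H_index = (\<lambda>g. - of_int (pos g))"
| "horofunction (R_plus_index f) = r_plus f"
| "horofunction (R_minus_index f) = r_minus f"
| "horofunction (B_plus_index c) = b_plus c"
| "horofunction (B_minus_index c) = b_minus c"

end

theory Submission
  imports Defs
begin

text \<open>
  The functions of the families \<open>s\<close>, \<open>H\<close>, \<open>- H\<close> depend on the position only. On the stands with a
  single lit lamp \<open>k\<close> and position 0, those of \<open>r\<^sup>+\<close> and \<open>b\<^sup>+\<close> are unbounded as \<open>k \<rightarrow> -\<infinity>\<close> but bounded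
  as \<open>k \<rightarrow> \<infinity>\<close>, and those of \<open>r\<^sup>-\<close> and \<open>b\<^sup>-\<close> behave the other way round. For position \<open>p\<close>, the stands
  minimising \<open>r\<^sup>+\<close> or \<open>b\<^sup>+\<close> are those that agree with the lamp configuration of the parameter
  to the left of \<open>min p l\<close> or \<open>p\<close> respectively; varying \<open>p\<close>, this tells the two kinds apart and
  recovers \<open>l\<close> and the configuration. Finally, the configuration determines the boundary class: a
  geodesic ray with \<open>H \<rightarrow> \<infinity>\<close> moves left only finitely often, so two rays with the same limit
  configuration eventually coincide up to a shift of time. The families with superscript \<open>-\<close>
  follow by a reflection.
\<close>

section \<open>Words in the generators\<close>

text \<open>The property minimised in \<open>word_length\<close>, with n free: the word need not be
  shortest, so exhibiting one bounds \<open>L2_dist\<close> from above.\<close>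

definition spells :: "nat \<Rightarrow> lampstand \<Rightarrow> bool" where
  "spells n g \<longleftrightarrow> (\<exists>ws. set ws \<subseteq> L2_letters \<and> length ws = n \<and> L2_word ws = g)"

lemma L2_dist_eq_Least: "L2_dist g h = (LEAST n. spells n (inv\<^bsub>L2\<^esub> g \<otimes>\<^bsub>L2\<^esub> h))"
  unfolding L2_dist_def word_length_def spells_def ..

lemma spells_L2_dist: "spells (L2_dist g h) (inv\<^bsub>L2\<^esub> g \<otimes>\<^bsub>L2\<^esub> h)"
proof -
  have "\<exists>n. spells n (inv\<^bsub>L2\<^esub> g \<otimes>\<^bsub>L2\<^esub> h)"
    using L2_generated unfolding spells_def by blast
  then show ?thesis unfolding L2_dist_eq_Least by (rule LeastI_ex)
qed

lemma L2_dist_one_le: "spells n g \<Longrightarrow> L2_dist \<one>\<^bsub>L2\<^esub> g \<le> n"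
  unfolding L2_dist_eq_Least by (rule Least_le) simp

lemma spells_0: "spells 0 \<one>\<^bsub>L2\<^esub>"
  unfolding spells_def by (rule exI[of _ "[]"]) simp

lemma spells_Suc:
  assumes "spells n g" "x \<in> L2_letters"
  shows "spells (Suc n) (g \<otimes>\<^bsub>L2\<^esub> x)"
proof -
  obtain ws where ws: "set ws \<subseteq> L2_letters" "length ws = n" "L2_word ws = g"
    using assms(1) unfolding spells_def by blast
  have "L2_word (ws @ [x]) = g \<otimes>\<^bsub>L2\<^esub> x"
    unfolding L2_word_append using ws(3) by simp
  moreover have "set (ws @ [x]) \<subseteq> L2_letters"
    using ws(1) assms(2) by (simp only: set_append list.set) blast
  moreover have "length (ws @ [x]) = Suc n" using ws(2) by simp
  ultimately show ?thesis unfolding spells_def by blast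
qed

text \<open>A single letter crosses one edge of the line, and the only lamp it can toggle is at the
  left end of that edge: \<open>at\<close> toggles before stepping right, its inverse after stepping
  left.\<close>

lemma L2_dist_1_cases:
  assumes "L2_dist g h = 1"
  shows "\<bar>pos h - pos g\<bar> = 1"
    and "i \<noteq> min (pos g) (pos h) \<Longrightarrow> i \<in> lit g \<longleftrightarrow> i \<in> lit h"
proof -
  obtain ws where ws: "set ws \<subseteq> L2_letters" "length ws = 1" "L2_word ws = inv\<^bsub>L2\<^esub> g \<otimes>\<^bsub>L2\<^esub> h"
    using spells_L2_dist[of g h] assms unfolding spells_def by auto
  then obtain x where "ws = [x]" by (metis One_nat_def length_0_conv length_Suc_conv)
  then have x: "x \<in> L2_letters" "x = inv\<^bsub>L2\<^esub> g \<otimes>\<^bsub>L2\<^esub> h" using ws by auto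
  then have h: "h = g \<otimes>\<^bsub>L2\<^esub> x" by (simp add: L2.m_assoc[symmetric])
  show "\<bar>pos h - pos g\<bar> = 1" using x(1) unfolding h pos_mult letters_eq by auto
  show "i \<in> lit g \<longleftrightarrow> i \<in> lit h" if "i \<noteq> min (pos g) (pos h)"
    using x(1) that unfolding h pos_mult letters_eq by (auto simp: lit_mult_iff simp del: fset_simps)
qed

text \<open>The path runs left to \<open>- m\<close> and then right, switching on lamps during the second part.\<close>

lemma spells_sweep:
  assumes "pos g = int k - int m" "lit g \<subseteq> {- int m..<int k - int m}"
  shows "spells (m + k) g"
  using assms
proof (induction k arbitrary: g)
  case 0
  have "spells m (Lampstand {||} (- int m))"
  proof (induction m)
    case 0
    then show ?case using spells_0 by (simp add: L2_def)
  next
    case (Suc m)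
    have "Lampstand {||} (- int (Suc m)) = Lampstand {||} (- int m) \<otimes>\<^bsub>L2\<^esub> Lampstand {||} (-1)"
      by (rule lampstand_eqI) (auto simp: lit_mult pos_mult)
    moreover have "Lampstand {||} (-1) \<in> L2_letters" unfolding letters_eq by simp
    ultimately show ?case using spells_Suc[OF Suc] by simp
  qed
  moreover have "g = Lampstand {||} (- int m)"
    using 0 by (intro lampstand_eqI) auto
  ultimately show ?case by simp
next
  case (Suc k)
  \<comment> \<open>The last letter steps from \<open>p\<close> to \<open>p + 1\<close>, lighting
    the lamp at \<open>p\<close> if \<open>g\<close> has it lit; \<open>g'\<close> is the stand just
    before.\<close>
  define p where "p = int k - int m"
  define g' where "g' = Lampstand (lamps g |-| {|p|}) p"
  define x where "x = Lampstand (if p \<in> lit g then {|0|} else {||}) 1"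
  have "g = g' \<otimes>\<^bsub>L2\<^esub> x"
    using Suc.prems(1) unfolding g'_def x_def
    by (intro lampstand_eqI) (auto simp: lit_mult pos_mult p_def)
  moreover have "x \<in> L2_letters" unfolding letters_eq x_def by simp
  moreover have "spells (m + k) g'"
    using Suc.prems(2) by (intro Suc.IH) (force simp: g'_def p_def)+
  ultimately show ?case using spells_Suc by simp
qed

subsection \<open>Rays moving to the right\<close>

context
  fixes \<gamma> :: "nat \<Rightarrow> lampstand"
  assumes ray: "\<gamma> \<in> rays at_top"
begin

lemma dist_ray: "int (L2_dist (\<gamma> m) (\<gamma> n)) = \<bar>int m - int n\<bar>"
  using ray by (simp add: rays_def geodesic_ray_def)

lemma pos_ray_Suc: "\<bar>pos (\<gamma> (Suc n)) - pos (\<gamma> n)\<bar> = 1"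
  and lit_ray_Suc: "i \<noteq> min (pos (\<gamma> n)) (pos (\<gamma> (Suc n))) \<Longrightarrow> i \<in> lit (\<gamma> n) \<longleftrightarrow> i \<in> lit (\<gamma> (Suc n))"
  using L2_dist_1_cases(1)[of "\<gamma> n" "\<gamma> (Suc n)"] L2_dist_1_cases(2)[of "\<gamma> n" "\<gamma> (Suc n)" i]
    dist_ray[of n "Suc n"] by auto

lemma ray_0: "pos (\<gamma> 0) = 0" "lit (\<gamma> 0) = {}"
  using ray by (simp_all add: rays_def lit_one pos_one)

text \<open>A step between positions in [a, b] can toggle only the left end of its edge, which is
  never b; hence the half-open interval.\<close>

lemma lit_ray_subset:
  "(\<And>j. j \<le> n \<Longrightarrow> a \<le> pos (\<gamma> j) \<and> pos (\<gamma> j) \<le> b) \<Longrightarrow> lit (\<gamma> n) \<subseteq> {a..<b}"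
proof (induction n)
  case 0
  then show ?case by (simp add: ray_0)
next
  case (Suc n)
  have "lit (\<gamma> n) \<subseteq> {a..<b}" using Suc by simp
  moreover have "min (pos (\<gamma> n)) (pos (\<gamma> (Suc n))) \<in> {a..<b}"
    using Suc.prems[of n] Suc.prems[of "Suc n"] pos_ray_Suc[of n] by auto
  ultimately have "i \<in> lit (\<gamma> (Suc n)) \<Longrightarrow> i \<in> {a..<b}" for i
    using lit_ray_Suc[of i n] by (cases "i = min (pos (\<gamma> n)) (pos (\<gamma> (Suc n)))") auto
  then show ?case by blast
qed

text \<open>The quantity \<open>int n - pos (\<gamma> n)\<close> is twice the number of left steps
  so far: a right step keeps it, a left step adds 2.\<close>

lemma pos_ray_mono_diff: "i \<le> j \<Longrightarrow> int i - pos (\<gamma> i) \<le> int j - pos (\<gamma> j)"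
proof (induction rule: dec_induct)
  case (step n)
  then show ?case using pos_ray_Suc[of n] by auto
qed simp

lemma pos_ray_at_top: "\<exists>N. \<forall>n\<ge>N. b \<le> pos (\<gamma> n)"
  using ray unfolding rays_def filterlim_at_top eventually_sequentially by simp

lemma pos_ray_bounded: obtains m :: nat where "\<And>n. - int m \<le> pos (\<gamma> n)"
proof -
  obtain N where N: "\<And>n. n \<ge> N \<Longrightarrow> 0 \<le> pos (\<gamma> n)" using pos_ray_at_top by blast
  have "\<exists>b. \<forall>n\<le>N. b \<le> pos (\<gamma> n)"
    by (rule exI[of _ "Min ((\<lambda>n. pos (\<gamma> n)) ` {..N})"]) auto
  then obtain b where b: "\<And>n. n \<le> N \<Longrightarrow> b \<le> pos (\<gamma> n)" by blast
  show thesis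
  proof (rule that)
    fix n show "- int (nat \<bar>b\<bar>) \<le> pos (\<gamma> n)"
      using N[of n] b[of n] by (cases "n \<le> N") auto
  qed
qed

text \<open>The first time at which the maximum up to time n is surpassed will do. At such a record
  all lit lamps lie left of the lamplighter, the shape that \<open>spells_sweep\<close>
  requires.\<close>

lemma ray_record: "\<exists>N\<ge>n. \<forall>j\<le>N. pos (\<gamma> j) \<le> pos (\<gamma> N)"
proof -
  define M where "M = Max ((\<lambda>n. pos (\<gamma> n)) ` {..n})"
  have M: "pos (\<gamma> j) \<le> M" if "j \<le> n" for j using that by (simp add: M_def)
  have "\<exists>N. M < pos (\<gamma> N)"
    using pos_ray_at_top[of "M + 1"] by (auto simp: add1_zle_eq)
  then obtain N where N: "M < pos (\<gamma> N)" "\<And>j. j < N \<Longrightarrow> \<not> M < pos (\<gamma> j)"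
    using exists_least_iff[of "\<lambda>N. M < pos (\<gamma> N)"] by blast
  have "n \<le> N" using M[of N] N(1) by (metis linorder_not_le nle_le)
  moreover have "pos (\<gamma> j) \<le> pos (\<gamma> N)" if "j \<le> N" for j
    using that N(1) N(2)[of j] by (cases "j = N") auto
  ultimately show ?thesis by blast
qed

text \<open>The number of steps to the left is bounded: at a time when the lamplighter stands at a new
  maximum, \<open>spells_sweep\<close> bounds it by the leftmost position ever visited.\<close>

lemma ray_tail:
  obtains c N where "\<And>n. n \<ge> N \<Longrightarrow> pos (\<gamma> n) = int n - c"
    and "\<And>n. n \<ge> N \<Longrightarrow> lit (\<gamma> n) = limit_lamps \<gamma> \<inter> {..<int n - c}"
proof -
  obtain m where m: "\<And>n. - int m \<le> pos (\<gamma> n)" using pos_ray_bounded by blast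
  \<comment> \<open>Twice the number of left steps up to time n; by \<open>pos_le\<close> the
    truncation in \<open>nat\<close> never acts.\<close>
  define f where "f n = nat (int n - pos (\<gamma> n))" for n
  have pos_le: "pos (\<gamma> n) \<le> int n" for n
    using pos_ray_mono_diff[of 0 n] by (simp add: ray_0)
  have f_le: "f n \<le> 2 * m" for n
  proof -
    obtain N where N: "n \<le> N" "\<forall>j\<le>N. pos (\<gamma> j) \<le> pos (\<gamma> N)" using ray_record by blast
    define k where "k = nat (pos (\<gamma> N) + int m)"
    have k: "pos (\<gamma> N) = int k - int m" using m[of N] by (simp add: k_def)
    have "lit (\<gamma> N) \<subseteq> {- int m..<pos (\<gamma> N)}"
      using m N(2) by (intro lit_ray_subset) simp
    then have "spells (m + k) (\<gamma> N)" using k by (intro spells_sweep) simp_all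
    then have "L2_dist \<one>\<^bsub>L2\<^esub> (\<gamma> N) \<le> m + k" by (rule L2_dist_one_le)
    moreover have "\<gamma> 0 = \<one>\<^bsub>L2\<^esub>" using ray by (simp add: rays_def)
    \<comment> \<open>The ray is geodesic, so N is the distance just bounded. As the position at
      time N is k - m, this gives \<open>N - pos (\<gamma> N)\<close> at most 2 m.\<close>
    ultimately have "N \<le> m + k" using dist_ray[of 0 N] by simp
    then show ?thesis using pos_ray_mono_diff[OF N(1)] k by (simp add: f_def)
  qed
  \<comment> \<open>Being nondecreasing and bounded, \<open>f\<close> is constant from a maximiser
    \<open>n0\<close> on: only right steps follow.\<close>
  obtain n0 where n0: "\<And>n. f n \<le> f n0"
    using ex_has_greatest_nat[of "\<lambda>_. True" 0 f "Suc (2 * m)"] f_le le_imp_less_Suc by blast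
  define c where "c = int (f n0)"
  have pos_tail: "pos (\<gamma> n) = int n - c" if "n \<ge> n0" for n
    using n0[of n] pos_ray_mono_diff[OF that] pos_le[of n] pos_le[of n0] by (simp add: f_def c_def)
  \<comment> \<open>The summand \<open>f n0\<close> makes \<open>int n - c\<close> at least
    \<open>n0\<close>, so that it also dominates the positions visited before time
    \<open>n0\<close>.\<close>
  define N where "N = n0 + f n0"
  show thesis
  proof (rule that)
    fix n assume n: "n \<ge> N"
    then have nn0: "n \<ge> n0" by (simp add: N_def)
    show "pos (\<gamma> n) = int n - c" using pos_tail nn0 .
    have "pos (\<gamma> j) \<le> int n - c" if "j \<le> n" for j
      using that pos_tail[of j] pos_le[of j] n by (cases "j \<ge> n0") (auto simp: N_def c_def)
    then have sub: "lit (\<gamma> n) \<subseteq> {- int m..<int n - c}" using m by (intro lit_ray_subset) simp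
    have const: "i \<in> lit (\<gamma> n') \<longleftrightarrow> i \<in> lit (\<gamma> n)" if "i < int n - c" "n' \<ge> n" for i n'
      using that(2)
    proof (induction rule: dec_induct)
      case (step k)
      have "pos (\<gamma> k) = int k - c" "pos (\<gamma> (Suc k)) = int (Suc k) - c"
        using step.hyps nn0 by (intro pos_tail; simp)+
      then have "i \<noteq> min (pos (\<gamma> k)) (pos (\<gamma> (Suc k)))" using that(1) step.hyps by simp
      then show ?case using lit_ray_Suc[of i k] step.IH by simp
    qed simp
    have "i \<in> limit_lamps \<gamma> \<longleftrightarrow> i \<in> lit (\<gamma> n)" if "i < int n - c" for i
    proof -
      have "\<forall>\<^sub>F k in sequentially. (i \<in> lit (\<gamma> k) \<longleftrightarrow> i \<in> limit_lamps \<gamma>) \<and> k \<ge> n"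
        using eventually_limit_lamps[OF _ ray, of i] eventually_ge_at_top[of n]
        by (simp add: eventually_conj)
      then obtain k where "i \<in> lit (\<gamma> k) \<longleftrightarrow> i \<in> limit_lamps \<gamma>" "k \<ge> n"
        using eventually_happens'[OF sequentially_bot] by blast
      then show ?thesis using const that by blast
    qed
    then show "lit (\<gamma> n) = limit_lamps \<gamma> \<inter> {..<int n - c}" using sub by auto
  qed
qed

lemma bdd_below_limit_lamps: "bdd_below (limit_lamps \<gamma>)"
proof -
  obtain m where m: "\<And>n. - int m \<le> pos (\<gamma> n)" using pos_ray_bounded by blast
  have "- int m \<le> i" if i: "i \<in> limit_lamps \<gamma>" for i
  proof -
    have "\<forall>\<^sub>F n in sequentially. i \<in> lit (\<gamma> n)" using i by (simp add: limit_lamps_def)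
    then obtain n where n: "i \<in> lit (\<gamma> n)"
      using eventually_happens'[OF sequentially_bot] by blast
    have "lit (\<gamma> n) \<subseteq> {- int m..<Max ((\<lambda>n. pos (\<gamma> n)) ` {..n})}"
      using m by (intro lit_ray_subset) simp
    then show ?thesis using n by auto
  qed
  then show ?thesis by (rule bdd_belowI)
qed

end

text \<open>By \<open>ray_tail\<close> the late stands of both rays depend only on position and
  common limit configuration, so one ray eventually follows the other with a constant delay.\<close>

lemma asymptotic_at_top:
  assumes "\<gamma> \<in> rays at_top" "\<gamma>' \<in> rays at_top" "limit_lamps \<gamma> = limit_lamps \<gamma>'"
  shows "asymptotic \<gamma> \<gamma>'"
proof -
  obtain c N where N: "\<And>n. n \<ge> N \<Longrightarrow> pos (\<gamma> n) = int n - c"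
    "\<And>n. n \<ge> N \<Longrightarrow> lit (\<gamma> n) = limit_lamps \<gamma> \<inter> {..<int n - c}"
    by (rule ray_tail[OF assms(1)]) blast
  obtain c' N' where N': "\<And>n. n \<ge> N' \<Longrightarrow> pos (\<gamma>' n) = int n - c'"
    "\<And>n. n \<ge> N' \<Longrightarrow> lit (\<gamma>' n) = limit_lamps \<gamma>' \<inter> {..<int n - c'}"
    by (rule ray_tail[OF assms(2)]) blast
  define K where "K = N + N' + nat \<bar>c - c'\<bar>"
  have "L2_dist (\<gamma> n) (\<gamma>' n) = nat \<bar>c - c'\<bar>" if n: "n \<ge> K" for n
  proof -
    \<comment> \<open>The time at which \<open>\<gamma>\<close> has the position that
      \<open>\<gamma>'\<close> has at time n; \<open>K\<close> is large enough for both tails to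
      apply.\<close>
    define k where "k = nat (int n + c - c')"
    have k: "int k = int n + c - c'" "k \<ge> N" "n \<ge> N'" using n by (auto simp: k_def K_def)
    have "\<gamma>' n = \<gamma> k"
      using N[OF k(2)] N'[OF k(3)] k(1) assms(3) by (intro lampstand_eqI) simp_all
    then show ?thesis using dist_ray[OF assms(1), of n k] k(1) by simp
  qed
  then have "L2_dist (\<gamma> n) (\<gamma>' n) \<in> (\<lambda>n. L2_dist (\<gamma> n) (\<gamma>' n)) ` {..<K} \<union> {nat \<bar>c - c'\<bar>}" for n
    by (cases "n < K") auto
  then have "range (\<lambda>n. L2_dist (\<gamma> n) (\<gamma>' n)) \<subseteq>
      (\<lambda>n. L2_dist (\<gamma> n) (\<gamma>' n)) ` {..<K} \<union> {nat \<bar>c - c'\<bar>}"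
    by blast
  then have "finite (range (\<lambda>n. L2_dist (\<gamma> n) (\<gamma>' n)))"
    by (rule finite_subset) simp
  then show ?thesis unfolding asymptotic_def by (rule bdd_above_finite)
qed

subsection \<open>Reflection\<close>

text \<open>The lamp at \<open>i\<close> is lit on the edge from \<open>i\<close> to \<open>i + 1\<close>, hence the reflection \<open>i \<mapsto> - 1 - i\<close> of lamps
  accompanies the reflection \<open>p \<mapsto> - p\<close> of positions. It exchanges \<open>t\<close> with its inverse and \<open>at\<close> with
  its inverse.\<close>

definition mirror :: "lampstand \<Rightarrow> lampstand" where
  "mirror g = Lampstand ((\<lambda>i. - 1 - i) |`| lamps g) (- pos g)"

abbreviation flip :: "int set \<Rightarrow> int set" where
  "flip A \<equiv> (\<lambda>i. - 1 - i) ` A"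

lemma in_flip_iff: "i \<in> flip A \<longleftrightarrow> - 1 - i \<in> A"
  by (auto simp: image_iff intro!: bexI[of _ "- 1 - i"])

lemma lit_mirror [simp]: "lit (mirror g) = flip (lit g)"
  and pos_mirror [simp]: "pos (mirror g) = - pos g"
  by (simp_all add: mirror_def)

lemma flip_flip [simp]: "flip (flip A) = A"
  by (simp add: image_image)

lemma mirror_mirror [simp]: "mirror (mirror g) = g"
  by (rule lampstand_eqI) simp_all

lemma mirror_inject [simp]: "mirror g = mirror h \<longleftrightarrow> g = h"
  by (metis mirror_mirror)

lemma mirror_mult: "mirror (g \<otimes>\<^bsub>L2\<^esub> h) = mirror g \<otimes>\<^bsub>L2\<^esub> mirror h"
  by (rule lampstand_eqI) (auto simp: set_eq_iff in_flip_iff lit_mult_iff pos_mult algebra_simps)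

lemma mirror_one [simp]: "mirror \<one>\<^bsub>L2\<^esub> = \<one>\<^bsub>L2\<^esub>"
  by (rule lampstand_eqI) (simp_all add: lit_one pos_one)

lemma spells_mirror: "spells n g \<Longrightarrow> spells n (mirror g)"
proof -
  assume "spells n g"
  then obtain ws where ws: "set ws \<subseteq> L2_letters" "length ws = n" "L2_word ws = g"
    unfolding spells_def by blast
  have "mirror ` L2_letters \<subseteq> L2_letters" unfolding letters_eq by (simp add: mirror_def)
  then have "set (map mirror ws) \<subseteq> L2_letters" using ws(1) unfolding set_map by blast
  moreover have "L2_word (map mirror ws) = mirror (L2_word ws)"
    by (induction ws) (simp_all add: mirror_mult)
  ultimately show ?thesis unfolding spells_def using ws(2,3) length_map by blast
qed

lemma L2_dist_mirror: "L2_dist (mirror g) (mirror h) = L2_dist g h"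
proof -
  let ?k = "inv\<^bsub>L2\<^esub> g \<otimes>\<^bsub>L2\<^esub> h"
  have "g \<otimes>\<^bsub>L2\<^esub> ?k = h" by (simp add: L2.m_assoc[symmetric])
  then have "mirror h = mirror g \<otimes>\<^bsub>L2\<^esub> mirror ?k" by (metis mirror_mult)
  then have "inv\<^bsub>L2\<^esub> (mirror g) \<otimes>\<^bsub>L2\<^esub> mirror h = mirror ?k"
    by (simp add: L2.m_assoc[symmetric])
  moreover have "spells n (mirror ?k) \<longleftrightarrow> spells n ?k" for n
    using spells_mirror mirror_mirror by metis
  ultimately show ?thesis unfolding L2_dist_eq_Least by simp
qed

lemma mirror_ray: "\<gamma> \<in> rays at_bot \<Longrightarrow> mirror \<circ> \<gamma> \<in> rays at_top"
  by (auto simp: rays_def geodesic_ray_def L2_dist_mirror filterlim_at_top filterlim_at_bot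
      le_minus_iff[of _ "pos _"])

lemma limit_lamps_mirror: "limit_lamps (mirror \<circ> \<gamma>) = flip (limit_lamps \<gamma>)"
  by (auto simp: limit_lamps_def set_eq_iff in_flip_iff)

lemma asymptotic_at_bot:
  assumes "\<gamma> \<in> rays at_bot" "\<gamma>' \<in> rays at_bot" "limit_lamps \<gamma> = limit_lamps \<gamma>'"
  shows "asymptotic \<gamma> \<gamma>'"
proof -
  have "asymptotic (mirror \<circ> \<gamma>) (mirror \<circ> \<gamma>')"
    using assms by (intro asymptotic_at_top mirror_ray) (simp_all add: limit_lamps_mirror)
  then show ?thesis by (simp add: asymptotic_def L2_dist_mirror)
qed

section \<open>Boundary classes and their configurations\<close>

text \<open>Being asymptotic is the same as sharing the limit configuration, so a class can be
  rebuilt from its configuration.\<close>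

lemma boundary_class_eq:
  assumes F: "F = at_top \<or> F = at_bot" and c: "c \<in> boundary F"
  shows "c = {\<gamma> \<in> rays F. limit_lamps \<gamma> = class_lamps c}"
proof -
  obtain \<gamma> where \<gamma>: "\<gamma> \<in> rays F" "c = asymptotic_rel F `` {\<gamma>}"
    using c by (auto simp: boundary_def quotient_def)
  have "(\<gamma>, \<gamma>') \<in> asymptotic_rel F \<longleftrightarrow> \<gamma>' \<in> rays F \<and> limit_lamps \<gamma>' = limit_lamps \<gamma>" for \<gamma>'
    using asymptotic_limit_lamps[OF F, of \<gamma> \<gamma>'] asymptotic_at_top[of \<gamma> \<gamma>']
      asymptotic_at_bot[of \<gamma> \<gamma>'] F \<gamma>(1)
    by (auto simp: asymptotic_rel_def)
  then show ?thesis using class_lamps_eq[OF F \<gamma>(1)] \<gamma>(2) by auto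
qed

lemma inj_on_class_lamps:
  assumes "F = at_top \<or> F = at_bot"
  shows "inj_on class_lamps (boundary F)"
proof (rule inj_onI)
  fix c c' assume c: "c \<in> boundary F" "c' \<in> boundary F" "class_lamps c = class_lamps c'"
  show "c = c'"
    by (rule trans[OF boundary_class_eq[OF assms c(1)]])
      (simp only: c(3) boundary_class_eq[OF assms c(2), symmetric])
qed

lemma bdd_below_class_lamps: "c \<in> boundary at_top \<Longrightarrow> bdd_below (class_lamps c)"
  using bdd_below_limit_lamps class_lamps_eq[of at_top] by (auto simp: boundary_def quotient_def)

lemma bdd_below_flip_class_lamps: "c \<in> boundary at_bot \<Longrightarrow> bdd_below (flip (class_lamps c))"
  using bdd_below_limit_lamps[OF mirror_ray] class_lamps_eq[of at_bot]
  by (auto simp: boundary_def quotient_def limit_lamps_mirror)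

subsection \<open>Separating the horofunctions\<close>

text \<open>The minimum subtracted in \<open>b_plus\<close> and \<open>r_plus\<close>, D being the
  lamps where parameter and argument differ. If D is unbounded below, \<open>real_of_ereal\<close>
  returns the meaningless value 0, hence the \<open>bdd_below\<close> assumptions.\<close>

definition clip :: "int set \<Rightarrow> int \<Rightarrow> real" where
  "clip D u = real_of_ereal (min (min_lamp D) (ereal (of_int u)))"

lemma ereal_le_min_lamp_iff: "ereal (of_int b) \<le> min_lamp D \<longleftrightarrow> (\<forall>i\<in>D. b \<le> i)"
  by (simp add: min_lamp_def le_INF_iff)

lemma ereal_clip:
  assumes "bdd_below D"
  shows "ereal (clip D u) = min (min_lamp D) (ereal (of_int u))"
proof -
  obtain b where "\<forall>i\<in>D. b \<le> i" using assms by (auto simp: bdd_below_def)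
  then have "ereal (of_int b) \<le> min_lamp D" by (simp add: ereal_le_min_lamp_iff)
  then show ?thesis
    unfolding clip_def by (cases "min_lamp D") (auto simp: min_def)
qed

lemma clip_le: "bdd_below D \<Longrightarrow> clip D u \<le> of_int u"
  by (subst ereal_less_eq(3)[symmetric]) (simp add: ereal_clip)

lemma clip_le_elem:
  assumes "bdd_below D" "i \<in> D"
  shows "clip D u \<le> of_int i"
proof -
  have "min_lamp D \<le> ereal (of_int i)"
    unfolding min_lamp_def using assms(2) by (rule INF_lower)
  then have "ereal (clip D u) \<le> ereal (of_int i)"
    unfolding ereal_clip[OF assms(1)] by (rule min.coboundedI1)
  then show ?thesis by simp
qed

lemma le_clip:
  assumes "b \<le> u" "\<And>i. i \<in> D \<Longrightarrow> b \<le> i"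
  shows "of_int b \<le> clip D u"
proof -
  have "bdd_below D" using assms(2) by (rule bdd_belowI)
  then have "ereal (of_int b) \<le> ereal (clip D u)"
    using assms ereal_le_min_lamp_iff[of b D] by (simp add: ereal_clip)
  then show ?thesis by simp
qed

lemma clip_eq_iff:
  assumes "bdd_below D"
  shows "clip D u = of_int u \<longleftrightarrow> D \<inter> {..<u} = {}"
proof
  assume "clip D u = of_int u"
  then show "D \<inter> {..<u} = {}" using clip_le_elem[OF assms, of _ u] by fastforce
next
  assume "D \<inter> {..<u} = {}"
  then have "of_int u \<le> clip D u" by (intro le_clip) force+
  then show "clip D u = of_int u" using clip_le[OF assms] by (rule antisym[rotated])
qed

text \<open>Carries the maxima in the minus families over to \<open>clip\<close>: the summand 1 is
  absorbed by i + 1 = -(-1 - i).\<close>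

lemma clip_flip: "real_of_ereal (max (max_lamp D + 1) (ereal (of_int (- u)))) = - clip (flip D) u"
proof -
  have "max_lamp D + 1 = - min_lamp (flip D)"
  \<comment> \<open>Adding 1 inside the supremum requires a nonempty set; for empty D both sides are
    -\<infinity>.\<close>
  proof (cases "D = {}")
    case True
    then show ?thesis by (simp add: max_lamp_def min_lamp_def bot_ereal_def top_ereal_def)
  next
    case False
    have "max_lamp D + 1 = (SUP i\<in>D. ereal (of_int i) + 1)"
      unfolding max_lamp_def using False by (subst SUP_ereal_add_left) simp_all
    also have "\<dots> = (SUP i\<in>D. - ereal (of_int (- 1 - i)))"
      by (intro SUP_cong) (simp_all add: one_ereal_def)
    also have "\<dots> = - min_lamp (flip D)"
      unfolding min_lamp_def image_image by (rule ereal_SUP_uminus_eq)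
    finally show ?thesis .
  qed
  then have "max (max_lamp D + 1) (ereal (of_int (- u))) = - min (min_lamp (flip D)) (ereal (of_int u))"
    by (auto simp: min_def max_def simp flip: uminus_ereal.simps)
  then show ?thesis by (simp add: clip_def)
qed

lemma bdd_below_sym_diff: "bdd_below A \<Longrightarrow> finite B \<Longrightarrow> bdd_below (sym_diff (A :: int set) B)"
  by (meson bdd_below_Un bdd_below_finite bdd_below_mono Diff_subset)

section \<open>Recovering parameters from minimisers\<close>

text \<open>The common shape of the plus families and the reflected minus families: A is the
  configuration of the parameter, U the cutoff. K stays unspecified because values are compared only
  at equal positions.\<close>

definition profile :: "int set \<Rightarrow> (int \<Rightarrow> int) \<Rightarrow> (lampstand \<Rightarrow> real) \<Rightarrow> bool" where
  "profile A U h \<longleftrightarrow>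
     bdd_below A \<and> (\<exists>K. \<forall>g. h g = K (pos g) - 2 * clip (sym_diff A (lit g)) (U (pos g)))"

text \<open>A may be infinite, but being bounded below it is finite below the cutoff; this part of A
  yields a minimiser at position p.\<close>

lemma profile_minimizer_exists:
  assumes "profile A U h"
  obtains Z where "fset Z = A \<inter> {..<U p}"
proof -
  obtain b where "\<forall>i\<in>A. b \<le> i" using assms by (auto simp: profile_def bdd_below_def)
  then have "finite (A \<inter> {..<U p})" by (auto intro: finite_subset[of _ "{b..<U p}"])
  then show thesis using that[of "Abs_fset (A \<inter> {..<U p})"] by (simp add: Abs_fset_inverse)
qed

text \<open>At a fixed position, minimising \<open>h\<close> means maximising \<open>clip\<close>,
  whose upper bound \<open>U p\<close> is attained at Z.\<close>

lemma profile_minimal_iff: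
  assumes "profile A U h"
  shows "(\<forall>Y. h (Lampstand W p) \<le> h (Lampstand Y p)) \<longleftrightarrow> sym_diff A (fset W) \<inter> {..<U p} = {}"
proof -
  obtain K where bdd: "bdd_below A"
    and h: "\<And>g. h g = K (pos g) - 2 * clip (sym_diff A (lit g)) (U (pos g))"
    using assms unfolding profile_def by blast
  have bdd': "bdd_below (sym_diff A (fset Y))" for Y
    using bdd by (rule bdd_below_sym_diff) simp
  obtain Z where Z: "fset Z = A \<inter> {..<U p}" using profile_minimizer_exists[OF assms] .
  have "sym_diff A (fset Z) \<inter> {..<U p} = {}" unfolding Z by blast
  then have "clip (sym_diff A (fset Z)) (U p) = of_int (U p)"
    unfolding clip_eq_iff[OF bdd'] .
  then have "(\<forall>Y. clip (sym_diff A (fset Y)) (U p) \<le> clip (sym_diff A (fset W)) (U p)) \<longleftrightarrow>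
      clip (sym_diff A (fset W)) (U p) = of_int (U p)"
    using clip_le[OF bdd', of _ "U p"] by (metis antisym)
  then show ?thesis unfolding clip_eq_iff[OF bdd'] by (simp add: h)
qed

text \<open>At a fixed position the minimisers of the function are the stands that agree with \<open>A\<close> to the
  left of \<open>U p\<close>; this family of stands determines \<open>U p\<close>.\<close>

lemma profile_clip_le:
  assumes "profile A U h" "profile A' U' h"
  shows "U' p \<le> U p"
proof (rule ccontr)
  assume less: "\<not> U' p \<le> U p"
  obtain Z where Z: "fset Z = A \<inter> {..<U p}" using profile_minimizer_exists[OF assms(1)] .
  have eq: "sym_diff A (fset W) \<inter> {..<U p} = {} \<longleftrightarrow> sym_diff A' (fset W) \<inter> {..<U' p} = {}" for W
    using profile_minimal_iff[OF assms(1), of W p] profile_minimal_iff[OF assms(2), of W p] by simp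
  have "sym_diff A (fset Z) \<inter> {..<U p} = {}" unfolding Z by blast
  then have "sym_diff A' (fset Z) \<inter> {..<U' p} = {}" unfolding eq .
  \<comment> \<open>The lamp at \<open>U p\<close> may be switched freely without losing minimality
    for A. If \<open>U p < U' p\<close>, only one of its two states agrees with
    \<open>A'\<close>.\<close>
  moreover have "sym_diff A (fset (finsert (U p) Z)) \<inter> {..<U p} = {}"
    unfolding finsert.rep_eq Z by blast
  then have "sym_diff A' (fset (finsert (U p) Z)) \<inter> {..<U' p} = {}" unfolding eq .
  ultimately show False using less Z by (auto simp: set_eq_iff dest!: spec[of _ "U p"])
qed

lemma profile_unique:
  assumes "profile A U h" "profile A' U' h"
  shows "U = U'" and "A \<inter> {..<U p} = A' \<inter> {..<U p}"
proof -
  show U: "U = U'"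
    using profile_clip_le[OF assms] profile_clip_le[OF assms(2,1)] by (intro ext antisym)
  obtain Z where Z: "fset Z = A \<inter> {..<U p}" using profile_minimizer_exists[OF assms(1)] .
  have "sym_diff A (fset Z) \<inter> {..<U p} = {}" unfolding Z by blast
  then have "sym_diff A' (fset Z) \<inter> {..<U p} = {}"
    using profile_minimal_iff[OF assms(1), of Z p] profile_minimal_iff[OF assms(2), of Z p] U by simp
  then show "A \<inter> {..<U p} = A' \<inter> {..<U p}" unfolding Z by blast
qed

lemma profile_min_unique:
  assumes "profile A (\<lambda>p. min p l) h" "profile A' (\<lambda>p. min p l') h"
    and "A \<subseteq> {..<l}" "A' \<subseteq> {..<l'}"
  shows "l = l'" "A = A'"
proof -
  \<comment> \<open>At the position \<open>max l l'\<close> the two cutoffs are l and l'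
    themselves.\<close>
  have "min (max l l') l = min (max l l') l'"
    by (rule fun_cong[OF profile_unique(1)[OF assms(1,2)]])
  then show l: "l = l'" by linarith
  show "A = A'" using profile_unique(2)[OF assms(1,2), of l] assms(3,4) l by auto
qed

text \<open>The first cutoff stops growing at l, the second does not.\<close>

lemma profile_min_id_distinct:
  assumes "profile A (\<lambda>p. min p l) h" "profile A' (\<lambda>p. p) h"
  shows False
  using fun_cong[OF profile_unique(1)[OF assms], of "l + 1"] by simp

lemma profile_id_unique:
  assumes "profile A (\<lambda>p. p) h" "profile A' (\<lambda>p. p) h"
  shows "A = A'"
proof -
  have "i \<in> A \<longleftrightarrow> i \<in> A'" for i
    using profile_unique(2)[OF assms, of "i + 1"] by (auto simp: set_eq_iff)
  then show ?thesis by blast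
qed

section \<open>Boundedness on stands with one lit lamp\<close>

text \<open>The range k < 0 here and k \<ge> 0 in \<open>right_bounded\<close> are exchanged by the
  lamp reflection, so composing with \<open>mirror\<close> swaps the two notions.\<close>

definition left_bounded :: "(lampstand \<Rightarrow> real) \<Rightarrow> bool" where
  "left_bounded h \<longleftrightarrow> (\<exists>C. \<forall>k<0. h (Lampstand {|k|} 0) \<le> C)"

definition right_bounded :: "(lampstand \<Rightarrow> real) \<Rightarrow> bool" where
  "right_bounded h \<longleftrightarrow> (\<exists>C. \<forall>k\<ge>0. h (Lampstand {|k|} 0) \<le> C)"

lemma left_bounded_mirror: "left_bounded (h \<circ> mirror) \<longleftrightarrow> right_bounded h"
  and right_bounded_mirror: "right_bounded (h \<circ> mirror) \<longleftrightarrow> left_bounded h"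
proof -
  have m: "mirror (Lampstand {|k|} 0) = Lampstand {|- 1 - k|} 0" for k
    by (simp add: mirror_def)
  have neg: "(\<forall>k<0. P (- 1 - k)) \<longleftrightarrow> (\<forall>k\<ge>0. P k)" for P :: "int \<Rightarrow> bool"
  proof (intro iffI allI impI)
    fix k :: int assume "\<forall>k<0. P (- 1 - k)" "0 \<le> k"
    then show "P k" using spec[of "\<lambda>k. k < 0 \<longrightarrow> P (- 1 - k)" "- 1 - k"] by simp
  qed simp
  have pos: "(\<forall>k\<ge>0. P (- 1 - k)) \<longleftrightarrow> (\<forall>k<0. P k)" for P :: "int \<Rightarrow> bool"
    using neg[of "\<lambda>k. P (- 1 - k)"] by simp
  show "left_bounded (h \<circ> mirror) \<longleftrightarrow> right_bounded h"
    unfolding left_bounded_def right_bounded_def o_apply m neg[of "\<lambda>k. h (Lampstand {|k|} 0) \<le> _"] ..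
  show "right_bounded (h \<circ> mirror) \<longleftrightarrow> left_bounded h"
    unfolding left_bounded_def right_bounded_def o_apply m pos[of "\<lambda>k. h (Lampstand {|k|} 0) \<le> _"] ..
qed

lemma bounded_if_pos:
  assumes "\<And>g. h g = K (pos g)"
  shows "left_bounded h" "right_bounded h"
  unfolding left_bounded_def right_bounded_def assms by auto

lemma profile_bounded:
  assumes "profile A U h"
  shows "\<not> left_bounded h" "right_bounded h"
proof -
  obtain K where bdd: "bdd_below A"
    and h: "\<And>g. h g = K (pos g) - 2 * clip (sym_diff A (lit g)) (U (pos g))"
    using assms unfolding profile_def by blast
  obtain b where b: "\<And>i. i \<in> A \<Longrightarrow> b \<le> i" using bdd by (auto simp: bdd_below_def)
  show "\<not> left_bounded h"
  proof
    assume "left_bounded h"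
    then obtain C where C: "\<And>k. k < 0 \<Longrightarrow> h (Lampstand {|k|} 0) \<le> C"
      unfolding left_bounded_def by blast
    \<comment> \<open>The first two bounds put k outside A and make it negative; the last one makes
      \<open>K 0 - 2 * k\<close> exceed C.\<close>
    define k where "k = min (min (b - 1) (- 1)) (\<lfloor>(K 0 - C) / 2\<rfloor> - 1)"
    have "k \<in> sym_diff A {k}" using b[of k] by (auto simp: k_def)
    then have "clip (sym_diff A {k}) (U 0) \<le> of_int k"
      using bdd by (intro clip_le_elem bdd_below_sym_diff) simp_all
    moreover have "K 0 - 2 * clip (sym_diff A {k}) (U 0) \<le> C"
      using C[of k] by (simp add: h k_def)
    moreover have "of_int k < (K 0 - C) / 2" unfolding k_def by linarith
    ultimately show False by simp
  qed
  \<comment> \<open>A common lower bound for A, for every lamp k \<ge> 0 and for the cutoff.\<close>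
  define e where "e = min b (min 0 (U 0))"
  have "h (Lampstand {|k|} 0) \<le> K 0 - 2 * of_int e" if "k \<ge> 0" for k
  proof -
    have "of_int e \<le> clip (sym_diff A {k}) (U 0)"
      using b that by (intro le_clip) (auto simp: e_def min_le_iff_disj)
    then show ?thesis by (simp add: h)
  qed
  then show "right_bounded h" unfolding right_bounded_def by blast
qed

section \<open>Profiles of the four families\<close>

lemma profile_b_plus:
  assumes "c \<in> boundary at_top"
  shows "profile (class_lamps c) (\<lambda>p. p) (b_plus c)"
  unfolding profile_def
  by (intro conjI bdd_below_class_lamps assms
      exI[of _ "\<lambda>p. 2 * real_of_ereal (min (min_lamp (class_lamps c)) 0) + of_int p"])
    (simp add: b_plus_def min_diff_def clip_def)

lemma profile_r_plus: "profile (lit f) (\<lambda>p. min p (pos f)) (r_plus f)"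
  unfolding profile_def
  by (intro conjI bdd_below_finite finite_fset
      exI[of _ "\<lambda>p. 2 * real_of_ereal (min (min_lamp (lit f)) (min (ereal (pos f)) 0))
        + of_int (\<bar>pos f\<bar> - \<bar>pos f - p\<bar>)"])
    (simp add: r_plus_def s_fun_def min_diff_def clip_def Let_def of_int_min ereal_min)

lemma sym_diff_flip: "flip (sym_diff A (flip B)) = sym_diff (flip A) B"
  by (auto simp: set_eq_iff in_flip_iff)

lemma profile_b_minus:
  assumes "c \<in> boundary at_bot"
  shows "profile (flip (class_lamps c)) (\<lambda>p. p) (b_minus c \<circ> mirror)"
  unfolding profile_def
proof (intro conjI bdd_below_flip_class_lamps assms exI allI)
  fix g
  show "(b_minus c \<circ> mirror) g =
    of_int (pos g) - 2 * real_of_ereal (max (max_lamp (class_lamps c) + 1) 0)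
    - 2 * clip (sym_diff (flip (class_lamps c)) (lit g)) (pos g)"
    using clip_flip[of "sym_diff (class_lamps c) (flip (lit g))" "pos g"]
    by (simp add: b_minus_def max_diff_def sym_diff_flip)
qed

lemma profile_r_minus:
  "profile (lit (mirror f)) (\<lambda>p. min p (pos (mirror f))) (r_minus f \<circ> mirror)"
  unfolding profile_def
proof (intro conjI bdd_below_finite finite_fset exI allI)
  fix g
  \<comment> \<open>Reflection turns the maximum of the positions into a minimum, giving the cutoff
    of a plus function with parameter \<open>mirror f\<close>.\<close>
  have "max (ereal (of_int (- pos g))) (ereal (of_int (pos f))) =
      ereal (of_int (- min (pos g) (- pos f)))"
    by (simp add: min_def max_def)
  then show "(r_minus f \<circ> mirror) g =
    of_int (\<bar>pos f\<bar> - \<bar>pos f + pos g\<bar>)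
      - 2 * real_of_ereal (max (max_lamp (lit f) + 1) (max (ereal (pos f)) 0))
    - 2 * clip (sym_diff (lit (mirror f)) (lit g)) (min (pos g) (pos (mirror f)))"
    using clip_flip[of "sym_diff (lit f) (flip (lit g))" "min (pos g) (- pos f)"]
    by (simp add: r_minus_def s_fun_def max_diff_def sym_diff_flip Let_def)
qed

section \<open>Injectivity within and across the families\<close>

lemma inj_on_flat: "inj_on horofunction (range S_index \<union> {H_index, Neg_H_index})"
proof -
  \<comment> \<open>Evaluating at l and at l' makes |l| - |l'| equal to both -|l - l'| and |l -
    l'|.\<close>
  have s: "l = l'" if eq: "s_fun l = s_fun l'" for l l'
    using fun_cong[OF eq, of "Lampstand {||} l"] fun_cong[OF eq, of "Lampstand {||} l'"]
    by (simp add: s_fun_def)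
  \<comment> \<open>\<open>s_fun l\<close> never exceeds |l|, whereas H, and likewise -H below,
    takes the value |l| + 1.\<close>
  have H: "s_fun l \<noteq> (\<lambda>g. of_int (pos g))" for l
  proof
    assume eq: "s_fun l = (\<lambda>g. of_int (pos g))"
    show False using fun_cong[OF eq, of "Lampstand {||} (\<bar>l\<bar> + 1)"] by (simp add: s_fun_def)
  qed
  have N: "s_fun l \<noteq> (\<lambda>g. - of_int (pos g))" for l
  proof
    assume eq: "s_fun l = (\<lambda>g. - of_int (pos g))"
    show False using fun_cong[OF eq, of "Lampstand {||} (- \<bar>l\<bar> - 1)"] by (simp add: s_fun_def)
  qed
  have HN: "(\<lambda>g. of_int (pos g) :: real) \<noteq> (\<lambda>g. - of_int (pos g))"
    by (metis lampstand.sel(2) of_int_1 one_neq_neg_one)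
  show ?thesis
    by (rule inj_onI) (use s H N HN H[symmetric] N[symmetric] HN[symmetric] in auto)
qed

lemma lit_subset_if_max_lamp_less:
  "max_lamp (lit f) < ereal (of_int (pos f)) \<Longrightarrow> lit f \<subseteq> {..<pos f}"
  by (auto simp: max_lamp_def dest: SUP_lessD)

text \<open>A lamp i \<ge> l goes to -1 - i < -l: the weak inequality of the minus family becomes
  the strict one of the plus family.\<close>

lemma lit_mirror_subset_if_le_min_lamp:
  "ereal (of_int (pos f)) \<le> min_lamp (lit f) \<Longrightarrow> lit (mirror f) \<subseteq> {..<pos (mirror f)}"
  by (force simp: ereal_le_min_lamp_iff)

lemma inj_on_plus:
  "inj_on horofunction
    ({R_plus_index f | f. max_lamp (lit f) < ereal (of_int (pos f))} \<union> B_plus_index ` boundary at_top)"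
    (is "inj_on _ ?P")
proof (rule inj_onI)
  fix x y assume xy: "x \<in> ?P" "y \<in> ?P" "horofunction x = horofunction y"
  have rr: "f = f'" if "lit f \<subseteq> {..<pos f}" "lit f' \<subseteq> {..<pos f'}" "r_plus f = r_plus f'" for f f'
    using profile_min_unique[OF profile_r_plus[of f], of "lit f'" "pos f'"] profile_r_plus[of f'] that
    by (simp add: lampstand_eqI)
  have rb: "r_plus f \<noteq> b_plus c" if "c \<in> boundary at_top" for f c
    using profile_min_id_distinct profile_r_plus profile_b_plus[OF that] by metis
  have bb: "c = c'" if "c \<in> boundary at_top" "c' \<in> boundary at_top" "b_plus c = b_plus c'" for c c'
    using profile_id_unique profile_b_plus that inj_onD[OF inj_on_class_lamps[of at_top]] by metis
  show "x = y"
    using xy rb rb[symmetric] by (auto del: subset_antisym intro!: rr bb dest!: lit_subset_if_max_lamp_less)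
qed

lemma inj_on_minus:
  "inj_on horofunction
    ({R_minus_index f | f. min_lamp (lit f) \<ge> ereal (of_int (pos f))} \<union> B_minus_index ` boundary at_bot)"
    (is "inj_on _ ?M")
proof (rule inj_onI)
  fix x y assume xy: "x \<in> ?M" "y \<in> ?M" "horofunction x = horofunction y"
  have rr: "f = f'"
    if "lit (mirror f) \<subseteq> {..<pos (mirror f)}" "lit (mirror f') \<subseteq> {..<pos (mirror f')}"
      "r_minus f = r_minus f'" for f f'
  proof -
    have "mirror f = mirror f'"
      using profile_min_unique[OF profile_r_minus[of f], of "lit (mirror f')" "pos (mirror f')"]
        profile_r_minus[of f'] that
      by (intro lampstand_eqI) (simp_all only:)
    then show ?thesis by simp
  qed
  have rb: "r_minus f \<noteq> b_minus c" if "c \<in> boundary at_bot" for f c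
    using profile_min_id_distinct profile_r_minus profile_b_minus[OF that] by metis
  have bb: "c = c'" if "c \<in> boundary at_bot" "c' \<in> boundary at_bot" "b_minus c = b_minus c'" for c c'
  proof -
    have "flip (class_lamps c) = flip (class_lamps c')"
      using profile_id_unique profile_b_minus that by metis
    then have "class_lamps c = class_lamps c'" by (metis flip_flip)
    then show ?thesis using inj_onD[OF inj_on_class_lamps[of at_bot]] that by blast
  qed
  show "x = y"
    using xy rb rb[symmetric]
    by (auto del: subset_antisym intro!: rr bb dest!: lit_mirror_subset_if_le_min_lamp simp del: lit_mirror pos_mirror)
qed

theorem mainTheorem4:
  shows "inj_on horofunction
    (range S_index
     \<union> {H_index, Neg_H_index}
     \<union> {R_plus_index f | f. max_lamp (lit f) < ereal (of_int (pos f))}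
     \<union> {R_minus_index f | f. min_lamp (lit f) \<ge> ereal (of_int (pos f))}
     \<union> B_plus_index ` boundary at_top
     \<union> B_minus_index ` boundary at_bot)"
proof -
  define F where "F = range S_index \<union> {H_index, Neg_H_index}"
  define P where "P = {R_plus_index f | f. max_lamp (lit f) < ereal (of_int (pos f))}
    \<union> B_plus_index ` boundary at_top"
  define M where "M = {R_minus_index f | f. min_lamp (lit f) \<ge> ereal (of_int (pos f))}
    \<union> B_minus_index ` boundary at_bot"
  have F: "left_bounded (horofunction x)" "right_bounded (horofunction x)" if "x \<in> F" for x
  proof -
    have "\<exists>K. \<forall>g. horofunction x g = K (pos g)"
      using that unfolding F_def by (auto simp: s_fun_def)
    then obtain K where "\<And>g. horofunction x g = K (pos g)" by blast
    then show "left_bounded (horofunction x)" "right_bounded (horofunction x)"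
      by (rule bounded_if_pos)+
  qed
  have P: "\<not> left_bounded (horofunction x)" if "x \<in> P" for x
    using that profile_bounded(1)[OF profile_r_plus] profile_bounded(1)[OF profile_b_plus]
    unfolding P_def by auto
  have M: "left_bounded (horofunction x)" "\<not> right_bounded (horofunction x)" if "x \<in> M" for x
    using that profile_bounded[OF profile_r_minus] profile_bounded[OF profile_b_minus]
    unfolding M_def by (auto simp: left_bounded_mirror right_bounded_mirror)
  have inj: "inj_on horofunction F" "inj_on horofunction P" "inj_on horofunction M"
    unfolding F_def P_def M_def by (rule inj_on_flat inj_on_plus inj_on_minus)+
  have "inj_on horofunction (F \<union> P \<union> M)"
  proof (rule inj_onI)
    fix x y assume xy: "x \<in> F \<union> P \<union> M" "y \<in> F \<union> P \<union> M" "horofunction x = horofunction y"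
    \<comment> \<open>The pair of boundedness properties tells the three groups apart, so indices
      with equal functions lie in the same group.\<close>
    then have "x \<in> F \<and> y \<in> F \<or> x \<in> P \<and> y \<in> P \<or> x \<in> M \<and> y \<in> M"
      using F[of x] F[of y] P[of x] P[of y] M[of x] M[of y] by auto
    then show "x = y" using inj xy(3) by (auto dest: inj_onD)
  qed
  moreover have "F \<union> P \<union> M = range S_index
     \<union> {H_index, Neg_H_index}
     \<union> {R_plus_index f | f. max_lamp (lit f) < ereal (of_int (pos f))}
     \<union> {R_minus_index f | f. min_lamp (lit f) \<ge> ereal (of_int (pos f))}
     \<union> B_plus_index ` boundary at_top
     \<union> B_minus_index ` boundary at_bot"
    unfolding F_def P_def M_def by blast
  ultimately show ?thesis by simp
qed

end
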